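(* For every uncountable $X\subset\omega_1$ the subspace $\mathrm{sgrp}(\mathcal{L}_X)$ of $\mathbb{T}^X$ is an $L$-space. In particular, $\mathrm{sgrp}(\mathcal{L}_X)$ is an $L$-subsemigroup of $\mathbb{T}^X$ with cancellation.
   Context: An $L$-space is a regular hereditarily Lindelöf nonseparable topological space. An $L$-(sub)semigroup is a topological (sub)semigroup whose underlying space is an $L$-space. A semigroup $H$ is with cancellation if for all $h,h',h''\in H$ each of the equalities $hh'=hh''$ and $h''h=h'h$ implies $h'=h''$. For a subset $A$ of a group, $\mathrm{sgrp}(A)$ is the smallest subsemigroup containing $A$. The function $\mathrm{osc}$ (Moore). Let $(e_\alpha)_{\alpha<\omega_1}$ be a coherent sequence: $e_\alpha:\alpha\to\omega$ is finite-to-one, and for all $\alpha<\beta$ the set $\{\xi<\alpha: e_\alpha(\xi)\ne e_\beta(\xi)\}$ is finite. Let $L:\{(\alpha,\beta)\in\omega_1^2:\alpha\le\beta\}\to[\omega_1]^{<\omega}$ be a function such that: (i) $L(\alpha,\beta)\subset\alpha$, and $L(\alpha,\beta)=\emptyset$ iff $\alpha=0$ or $\alpha=\beta$; (ii) if $\alpha\le\beta\le\gamma$ and $L(\beta,\gamma)<L(\alpha,\beta)$ (every element of the first set is less than every element of the second), then $L(\alpha,\gamma)=L(\beta,\gamma)\cup L(\alpha,\beta)$; (iii) if $\beta$ is a limit ordinal, then $\lim_{\alpha\to\beta}\min L(\alpha,\beta)=\beta$. For $\alpha<\beta<\omega_1$, $\mathrm{osc}(\alpha,\beta)\in\omega$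 is the cardinality of the set of all $\xi\in L(\alpha,\beta)\setminus\{\min L(\alpha,\beta)\}$ such that $e_\alpha(\xi^-)=e_\beta(\xi^-)$ and $e_\alpha(\xi)>e_\beta(\xi)$, where $\xi^-$ is the greatest element of $L(\alpha,\beta)$ smaller than $\xi$. Moore's choice of these objects, which is fixed here, has the following property (a known theorem of Moore, which may be assumed): for all uncountable families $\mathcal{A}\subset[\omega_1]^k$ and $\mathcal{B}\subset[\omega_1]^l$ of pairwise disjoint sets and every $n\in\omega$ there exist $a\in\mathcal{A}$ and $b_m\in\mathcal{B}$ ($m<n$) such that for all $i<k$, $j<l$, $m<n$: $a<b_m$ (i.e. $\max a<\min b_m$) and $\mathrm{osc}(a(i),b_m(j))=\mathrm{osc}(a(i),b_0(j))+m$. Here $a(i)$ denotes the $i$-th element of $a$ in increasing order (starting from $i=0$). Let $\mathbb{T}=\{z\in\mathbb{C}:|z|=1\}$ (a multiplicative group), and fix a sequence $(z_\alpha)_{\alpha<\omega_1}$ of rationally independent points of $\mathbb{T}$ (no nontrivial finite product of integer powers of distinct $z_\alpha$'s equals $1$). For $\alpha<\beta<\omega_1$ put $o(\alpha,\beta)=z_\alpha^{\mathrm{osc}(\alpha,\beta)+1}$. Define $w_\beta\in\mathbb{T}^{\omega_1}$ by $w_\beta(\alpha)=o(\alpha,\beta)$ if $\alpha<\beta$ and $w_\beta(\alpha)=1$ otherwise. For $X\subset\omega_1$ let $\mathcal{L}_X=\{w_\beta|X:\beta\in X\}\subset\mathbb{T}^X$, where $\mathbb{T}^X$ has the product topology and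 coordinatewise multiplication.
   Formalization: Condition (ii) on L is required only for α>0: for α=0<β<γ it would, as literally written, give L(0,γ)=L(β,γ), contradicting (i), since L(0,γ) is empty and L(β,γ) is not. *)

theory Defs
  imports "HOL-Analysis.Analysis" "HOL-Algebra.Product_Groups"
begin

unbundle cardinal_syntax

text \<open>\<open>natLeq\<close> is the cardinal \<open>\<omega>\<close>, so the well-order \<open>cardSuc natLeq\<close> is \<open>\<omega>\<^sub>1\<close>. Ordinals below
  \<open>\<omega>\<^sub>1\<close> are the elements of the following type, and an ordinal \<open>\<alpha>\<close> as a set is \<open>{..<\<alpha>}\<close>.\<close>

lemma Field_cardSuc_natLeq_nonempty: "Field (cardSuc natLeq) \<noteq> {}"
  using cardSuc_finite[OF natLeq_Card_order] by (force simp: Field_natLeq)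

typedef omega1 = "Field (cardSuc natLeq)"
  using Field_cardSuc_natLeq_nonempty by blast

lemma Card_order_cardSuc_natLeq: "Card_order (cardSuc natLeq)"
  by (simp add: cardSuc_Card_order natLeq_Card_order)

lemma Well_order_cardSuc_natLeq: "Well_order (cardSuc natLeq)"
  using Card_order_cardSuc_natLeq card_order_on_well_order_on by blast

instantiation omega1 :: wellorder
begin

definition less_eq_omega1 :: "omega1 \<Rightarrow> omega1 \<Rightarrow> bool" where
  "\<alpha> \<le> \<beta> \<longleftrightarrow> (Rep_omega1 \<alpha>, Rep_omega1 \<beta>) \<in> cardSuc natLeq"

definition less_omega1 :: "omega1 \<Rightarrow> omega1 \<Rightarrow> bool" where
  "\<alpha> < \<beta> \<longleftrightarrow> \<alpha> \<le> \<beta> \<and> \<not> \<beta> \<le> (\<alpha> :: omega1)"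

instance
proof
  let ?r = "cardSuc natLeq"
  have lin: "refl_on (Field ?r) ?r" "trans ?r" "antisym ?r" "total_on (Field ?r) ?r" "wf (?r - Id)"
    using Well_order_cardSuc_natLeq
    by (auto simp: order_on_defs)
  fix \<alpha> \<beta> \<gamma> :: omega1
  show "(\<alpha> < \<beta>) = (\<alpha> \<le> \<beta> \<and> \<not> \<beta> \<le> \<alpha>)"
    by (rule less_omega1_def)
  show "\<alpha> \<le> \<alpha>"
    using lin(1) Rep_omega1 by (auto simp: less_eq_omega1_def refl_on_def)
  show "\<alpha> \<le> \<gamma>" if "\<alpha> \<le> \<beta>" "\<beta> \<le> \<gamma>"
    using that lin(2) unfolding less_eq_omega1_def by (meson transD)
  show anti: "\<alpha> = \<beta>" if "\<alpha> \<le> \<beta>" "\<beta> \<le> \<alpha>" for \<alpha> \<beta> :: omega1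
    using that lin(3) unfolding less_eq_omega1_def by (meson antisymD Rep_omega1_inject)
  show "\<alpha> \<le> \<beta> \<or> \<beta> \<le> \<alpha>"
    using lin(1,4) Rep_omega1[of \<alpha>] Rep_omega1[of \<beta>]
    unfolding less_eq_omega1_def by (metis refl_onD total_on_def)
  fix P :: "omega1 \<Rightarrow> bool" and \<delta>
  assume step: "\<And>x. (\<And>y. y < x \<Longrightarrow> P y) \<Longrightarrow> P x"
  have "{(x, y). x < y} \<subseteq> inv_image (?r - Id) Rep_omega1"
    by (auto simp: less_omega1_def less_eq_omega1_def inv_image_def)
  then have "wf {(x :: omega1, y). x < y}"
    using lin(5) wf_inv_image wf_subset by blast
  then show "P \<delta>"
    by (rule wf_induct_rule) (use step in blast)
qed

end

instantiation omega1 :: linorder_topology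
begin

definition open_omega1 :: "omega1 set \<Rightarrow> bool" where
  "open_omega1 = generate_topology (range (\<lambda>\<alpha>. {..<\<alpha>}) \<union> range (\<lambda>\<alpha>. {\<alpha><..}))"

instance
  by standard (rule open_omega1_def)

end

instantiation omega1 :: zero
begin

definition zero_omega1 :: omega1 where "0 = (LEAST \<alpha> :: omega1. True)"

instance ..

end

lemma omega1_zero_le: "0 \<le> (\<alpha> :: omega1)"
  by (simp add: zero_omega1_def Least_le)

lemma omega1_uncountable: "uncountable (UNIV :: omega1 set)"
proof
  assume "countable (UNIV :: omega1 set)"
  then have "countable (range Rep_omega1)" by simp
  then have "countable (Field (cardSuc natLeq))"
    by (simp add: type_definition.Rep_range[OF type_definition_omega1])
  then have "|Field (cardSuc natLeq)| \<le>o |UNIV :: nat set|"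
    unfolding countable_def card_of_ordLeq[symmetric] by blast
  then have "|Field (cardSuc natLeq)| \<le>o natLeq"
    using card_of_nat ordLeq_ordIso_trans by blast
  moreover have "natLeq <o |Field (cardSuc natLeq)|"
    using cardSuc_greater[OF natLeq_Card_order] card_of_Field_ordIso[OF Card_order_cardSuc_natLeq]
      ordIso_symmetric ordLess_ordIso_trans by blast
  ultimately show False
    using not_ordLess_ordLeq by blast
qed

lemma omega1_countable_lessThan: "countable {..<\<alpha> :: omega1}"
proof -
  let ?r = "cardSuc natLeq"
  have "Rep_omega1 ` {..<\<alpha>} \<subseteq> underS ?r (Rep_omega1 \<alpha>)"
    by (auto simp: underS_def less_omega1_def less_eq_omega1_def)
  moreover have "|underS ?r (Rep_omega1 \<alpha>)| <o ?r"
    using card_of_underS[OF Card_order_cardSuc_natLeq Rep_omega1] .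
  then have "|underS ?r (Rep_omega1 \<alpha>)| \<le>o natLeq"
    using cardSuc_ordLeq_ordLess[OF natLeq_Card_order card_of_Card_order] by blast
  then have "|underS ?r (Rep_omega1 \<alpha>)| \<le>o |UNIV :: nat set|"
    using card_of_nat ordIso_symmetric ordLeq_ordIso_trans by blast
  then have "countable (underS ?r (Rep_omega1 \<alpha>))"
    unfolding countable_def card_of_ordLeq[symmetric] by blast
  ultimately have "countable (Rep_omega1 ` {..<\<alpha>})"
    using countable_subset by blast
  then show ?thesis
    by (rule countable_image_inj_on) (simp add: inj_on_def Rep_omega1_inject)
qed

unbundle no cardinal_syntax

definition limit_ordinal :: "omega1 \<Rightarrow> bool" where
  "limit_ordinal \<beta> \<longleftrightarrow> \<beta> \<noteq> 0 \<and> (\<forall>\<alpha><\<beta>. \<exists>\<gamma>. \<alpha> < \<gamma> \<and> \<gamma> < \<beta>)"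

definition set_less :: "omega1 set \<Rightarrow> omega1 set \<Rightarrow> bool" where
  "set_less a b \<longleftrightarrow> (\<forall>x\<in>a. \<forall>y\<in>b. x < y)"

text \<open>Only the values \<open>e \<alpha> \<xi>\<close> with \<open>\<xi> < \<alpha>\<close> and \<open>L \<alpha> \<beta>\<close> with \<open>\<alpha> \<le> \<beta>\<close> are meaningful below.\<close>

definition coherent_sequence :: "(omega1 \<Rightarrow> omega1 \<Rightarrow> nat) \<Rightarrow> bool" where
  "coherent_sequence e \<longleftrightarrow>
     (\<forall>\<alpha> n. finite {\<xi>. \<xi> < \<alpha> \<and> e \<alpha> \<xi> = n}) \<and>
     (\<forall>\<alpha> \<beta>. \<alpha> < \<beta> \<longrightarrow> finite {\<xi>. \<xi> < \<alpha> \<and> e \<alpha> \<xi> \<noteq> e \<beta> \<xi>})"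

text \<open>In the concatenation clause \<open>\<alpha> = 0\<close> has to be excluded: \<open>L 0 \<beta>\<close> is empty, so for
  \<open>0 < \<beta> < \<gamma>\<close> the clause would give \<open>L \<beta> \<gamma> = L 0 \<gamma> = {}\<close>, against the first clause.\<close>

definition lower_trace :: "(omega1 \<Rightarrow> omega1 \<Rightarrow> omega1 set) \<Rightarrow> bool" where
  "lower_trace L \<longleftrightarrow>
     (\<forall>\<alpha> \<beta>. \<alpha> \<le> \<beta> \<longrightarrow>
        finite (L \<alpha> \<beta>) \<and> L \<alpha> \<beta> \<subseteq> {..<\<alpha>} \<and> (L \<alpha> \<beta> = {} \<longleftrightarrow> \<alpha> = 0 \<or> \<alpha> = \<beta>)) \<and>
     (\<forall>\<alpha> \<beta> \<gamma>. 0 < \<alpha> \<and> \<alpha> \<le> \<beta> \<and> \<beta> \<le> \<gamma> \<and> set_less (L \<beta> \<gamma>) (L \<alpha> \<beta>) \<longrightarrow>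
        L \<alpha> \<gamma> = L \<beta> \<gamma> \<union> L \<alpha> \<beta>) \<and>
     (\<forall>\<beta>. limit_ordinal \<beta> \<longrightarrow> ((\<lambda>\<alpha>. Min (L \<alpha> \<beta>)) \<longlongrightarrow> \<beta>) (at_left \<beta>))"

definition osc ::
  "(omega1 \<Rightarrow> omega1 \<Rightarrow> nat) \<Rightarrow> (omega1 \<Rightarrow> omega1 \<Rightarrow> omega1 set) \<Rightarrow> omega1 \<Rightarrow> omega1 \<Rightarrow> nat" where
  "osc e L \<alpha> \<beta> = card {\<xi> \<in> L \<alpha> \<beta> - {Min (L \<alpha> \<beta>)}.
     let \<xi>' = Max {\<eta> \<in> L \<alpha> \<beta>. \<eta> < \<xi>} in e \<alpha> \<xi>' = e \<beta> \<xi>' \<and> e \<alpha> \<xi> > e \<beta> \<xi>}"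

text \<open>The conclusion of Moore's theorem; \<open>sorted_list_of_set a ! i\<close> is \<open>a(i)\<close>.\<close>

definition moore_property :: "(omega1 \<Rightarrow> omega1 \<Rightarrow> nat) \<Rightarrow> bool" where
  "moore_property f \<longleftrightarrow>
     (\<forall>k l (\<A> :: omega1 set set) (\<B> :: omega1 set set) n.
        uncountable \<A> \<and> (\<forall>a\<in>\<A>. finite a \<and> card a = k) \<and> disjoint \<A> \<and>
        uncountable \<B> \<and> (\<forall>b\<in>\<B>. finite b \<and> card b = l) \<and> disjoint \<B> \<longrightarrow>
        (\<exists>a\<in>\<A>. \<exists>b :: nat \<Rightarrow> omega1 set. (\<forall>m<n. b m \<in> \<B>) \<and>
           (\<forall>i<k. \<forall>j<l. \<forall>m<n. set_less a (b m) \<and>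
              f (sorted_list_of_set a ! i) (sorted_list_of_set (b m) ! j) =
              f (sorted_list_of_set a ! i) (sorted_list_of_set (b 0) ! j) + m)))"

text \<open>Regular spaces are taken to be \<open>T\<^sub>1\<close>, hence Hausdorff; this is not part of \<open>regular_space\<close>.\<close>

definition L_space :: "'a topology \<Rightarrow> bool" where
  "L_space \<tau> \<longleftrightarrow> regular_space \<tau> \<and> t1_space \<tau> \<and> hereditarily Lindelof_space \<tau> \<and> \<not> separable_space \<tau>"

definition subsemigroup :: "'a set \<Rightarrow> ('a, 'b) monoid_scheme \<Rightarrow> bool" where
  "subsemigroup H G \<longleftrightarrow> H \<subseteq> carrier G \<and> (\<forall>x\<in>H. \<forall>y\<in>H. x \<otimes>\<^bsub>G\<^esub> y \<in> H)"

definition sgrp :: "('a, 'b) monoid_scheme \<Rightarrow> 'a set \<Rightarrow> 'a set" where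
  "sgrp G A = (\<lambda>H. subsemigroup H G) hull A"

definition topological_semigroup :: "'a topology \<Rightarrow> ('a \<Rightarrow> 'a \<Rightarrow> 'a) \<Rightarrow> bool" where
  "topological_semigroup \<tau> mul \<longleftrightarrow>
     (\<forall>x\<in>topspace \<tau>. \<forall>y\<in>topspace \<tau>. mul x y \<in> topspace \<tau>) \<and>
     (\<forall>x\<in>topspace \<tau>. \<forall>y\<in>topspace \<tau>. \<forall>z\<in>topspace \<tau>. mul (mul x y) z = mul x (mul y z)) \<and>
     continuous_map (prod_topology \<tau> \<tau>) \<tau> (\<lambda>(x, y). mul x y)"

definition L_subsemigroup :: "('a, 'b) monoid_scheme \<Rightarrow> 'a topology \<Rightarrow> 'a set \<Rightarrow> bool" where
  "L_subsemigroup G \<tau> H \<longleftrightarrow>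
     subsemigroup H G \<and> topological_semigroup (subtopology \<tau> H) (mult G) \<and> L_space (subtopology \<tau> H)"

definition cancellative :: "('a, 'b) monoid_scheme \<Rightarrow> 'a set \<Rightarrow> bool" where
  "cancellative G H \<longleftrightarrow>
     (\<forall>h\<in>H. \<forall>h'\<in>H. \<forall>h''\<in>H.
        (h \<otimes>\<^bsub>G\<^esub> h' = h \<otimes>\<^bsub>G\<^esub> h'' \<longrightarrow> h' = h'') \<and>
        (h'' \<otimes>\<^bsub>G\<^esub> h = h' \<otimes>\<^bsub>G\<^esub> h \<longrightarrow> h' = h''))"

definition circle_group :: "complex monoid" where
  "circle_group = \<lparr>carrier = sphere 0 1, monoid.mult = (*), one = 1\<rparr>"

definition torus_group :: "omega1 set \<Rightarrow> (omega1 \<Rightarrow> complex) monoid" where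
  "torus_group X = product_group X (\<lambda>_. circle_group)"

definition torus_topology :: "omega1 set \<Rightarrow> (omega1 \<Rightarrow> complex) topology" where
  "torus_topology X = product_topology (\<lambda>_. top_of_set (sphere 0 1)) X"

definition rationally_independent :: "(omega1 \<Rightarrow> complex) \<Rightarrow> bool" where
  "rationally_independent z \<longleftrightarrow>
     (\<forall>F (n :: omega1 \<Rightarrow> int). finite F \<and> (\<Prod>\<alpha>\<in>F. z \<alpha> powi n \<alpha>) = 1 \<longrightarrow> (\<forall>\<alpha>\<in>F. n \<alpha> = 0))"

definition w_point ::
  "(omega1 \<Rightarrow> omega1 \<Rightarrow> nat) \<Rightarrow> (omega1 \<Rightarrow> omega1 \<Rightarrow> omega1 set) \<Rightarrow> (omega1 \<Rightarrow> complex) \<Rightarrow>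
   omega1 \<Rightarrow> omega1 \<Rightarrow> complex" where
  "w_point e L z \<beta> \<alpha> = (if \<alpha> < \<beta> then z \<alpha> ^ (osc e L \<alpha> \<beta> + 1) else 1)"

definition L_set ::
  "(omega1 \<Rightarrow> omega1 \<Rightarrow> nat) \<Rightarrow> (omega1 \<Rightarrow> omega1 \<Rightarrow> omega1 set) \<Rightarrow> (omega1 \<Rightarrow> complex) \<Rightarrow>
   omega1 set \<Rightarrow> (omega1 \<Rightarrow> complex) set" where
  "L_set e L z X = (\<lambda>\<beta>. restrict (w_point e L z \<beta>) X) ` X"

end

theory Submission
  imports Defs
begin

text \<open>
  Regularity, the \<open>T\<^sub>1\<close> axiom, cancellation and continuity of the multiplication are inherited from the
  torus \<open>\<T>\<^sup>X\<close>. The space is not separable because each element of the semigroup is \<open>1\<close> at all but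
  countably many coordinates, while at every coordinate of \<open>X\<close> some element is not \<open>1\<close>
  (\<open>not_separable_sgrp_L_set\<close>).

  The substance is the hereditary Lindeloef property (\<open>hereditarily_Lindelof_sgrp_L_set\<close>). If it fails,
  there is a right separated \<open>\<omega>\<^sub>1\<close>-sequence: points \<open>x\<^sub>\<xi>\<close> with neighbourhoods \<open>U\<^sub>\<xi>\<close> such that \<open>x\<^sub>\<eta> \<notin> U\<^sub>\<xi>\<close> for
  \<open>\<xi> < \<eta>\<close> (\<open>right_separated_sequence\<close>). Each \<open>x\<^sub>\<xi>\<close> is a finite product of powers of points \<open>w\<^sub>\<beta>\<close>, and
  \<open>U\<^sub>\<xi>\<close> restricts finitely many coordinates up to some \<open>\<epsilon>\<close>. By the \<open>\<Delta>\<close>-system lemma (\<open>delta_system\<close>)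
  and a pigeonhole argument, the finite sets of indices and coordinates may be taken to be
  \<open>r \<union> b\<^sub>\<xi>\<close> with the \<open>b\<^sub>\<xi>\<close> disjoint, all multiplicities and \<open>\<epsilon>\<close> to be independent of \<open>\<xi>\<close>, and the points
  to be \<open>\<epsilon>\<close>-close to each other on the coordinates in \<open>r\<close>. Moore's property then gives one \<open>b\<^sub>\<xi>\<close> and
  many sets \<open>b\<^sub>\<eta>\<close>, for \<open>\<eta> = \<eta>\<^sub>0, \<eta>\<^sub>1, \<dots>\<close>, above it, for which all oscillations grow by \<open>m\<close> from
  \<open>\<eta>\<^sub>0\<close> to \<open>\<eta>\<^sub>m\<close>. Consequently the \<open>\<alpha>\<close>-th coordinate of the \<open>m\<close>-th point is a fixed element of the
  circle times \<open>(z\<^sub>\<alpha>\<^sup>S)\<^sup>m\<close>, for every \<open>\<alpha> \<in> b\<^sub>\<xi>\<close>, where \<open>S\<close> is the total multiplicity outside the root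
  (\<open>w_prod_shift\<close>). If \<open>S > 0\<close>, the \<open>z\<^sub>\<alpha>\<^sup>S\<close> are rationally independent, so by Kronecker's theorem some \<open>m\<close>
  brings all these coordinates close to those of \<open>x\<^sub>\<xi>\<close>; the number of \<open>m\<close> that have to be tried is bounded
  in advance by compactness (\<open>kronecker_uniform\<close>). If \<open>S = 0\<close>, all the points are equal. In both cases
  \<open>x\<^sub>\<eta> \<in> U\<^sub>\<xi>\<close> for some \<open>\<eta> > \<xi>\<close>, a contradiction.
\<close>

section \<open>Uncountable families\<close>

lemma uncountable_fibre:
  fixes f :: "'a \<Rightarrow> 'c::countable"
  assumes "uncountable Z"
  obtains c where "uncountable {x\<in>Z. f x = c}"
proof -
  have "Z = (\<Union>c. {x\<in>Z. f x = c})" by auto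
  then show ?thesis
    using assms that countable_UN[of UNIV "\<lambda>c. {x\<in>Z. f x = c}"] by (metis countableI_type)
qed

text \<open>The \<open>\<Delta>\<close>-system lemma for sets of equal size \<open>k\<close>, by induction on \<open>k\<close>. A point that lies in
  uncountably many of the sets goes into the root, and the induction hypothesis is applied to the sets
  without it. If every point lies in countably many sets only, then a maximal disjoint subfamily is
  uncountable: the union of a countable one would be countable, hence meet only countably many sets,
  and any other set could be added.\<close>

lemma delta_system_card:
  fixes a :: "'i \<Rightarrow> 'a set"
  assumes "uncountable Z" and "\<And>x. x \<in> Z \<Longrightarrow> finite (a x) \<and> card (a x) = k"
  shows "\<exists>Y r. Y \<subseteq> Z \<and> uncountable Y \<and> (\<forall>x\<in>Y. \<forall>y\<in>Y. x \<noteq> y \<longrightarrow> a x \<inter> a y = r)"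
  using assms
proof (induction k arbitrary: a Z)
  case 0
  have "a x = {}" if "x \<in> Z" for x using 0(2)[OF that] card_0_eq by blast
  then show ?case using 0 by (intro exI[of _ Z] exI[of _ "{}"]) auto
next
  case (Suc k)
  show ?case
  proof (cases "\<exists>v. uncountable {x\<in>Z. v \<in> a x}")
    case True
    then obtain v where v: "uncountable {x\<in>Z. v \<in> a x}" ..
    have "\<exists>Y r. Y \<subseteq> {x\<in>Z. v \<in> a x} \<and> uncountable Y \<and>
      (\<forall>x\<in>Y. \<forall>y\<in>Y. x \<noteq> y \<longrightarrow> (a x - {v}) \<inter> (a y - {v}) = r)"
      by (rule Suc.IH[OF v]) (use Suc.prems(2) in auto)
    then obtain Y r where Y: "Y \<subseteq> {x\<in>Z. v \<in> a x}" "uncountable Y"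
      and r: "\<forall>x\<in>Y. \<forall>y\<in>Y. x \<noteq> y \<longrightarrow> (a x - {v}) \<inter> (a y - {v}) = r" by (elim exE conjE)
    have "a x \<inter> a y = insert v r" if "x \<in> Y" "y \<in> Y" "x \<noteq> y" for x y
    proof -
      have "v \<in> a x" "v \<in> a y" using Y(1) that by auto
      moreover have "(a x - {v}) \<inter> (a y - {v}) = r" using r that by simp
      ultimately show ?thesis by auto
    qed
    with Y show ?thesis by (intro exI[of _ Y] exI[of _ "insert v r"]) auto
  next
    case False
    define D where "D = {Y. Y \<subseteq> Z \<and> (\<forall>x\<in>Y. \<forall>y\<in>Y. x \<noteq> y \<longrightarrow> a x \<inter> a y = {})}"
    have "\<exists>M\<in>D. \<forall>Y\<in>D. M \<subseteq> Y \<longrightarrow> Y = M"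
    proof (rule Zorn_Lemma2, intro ballI)
      fix C assume C: "C \<in> chains D"
      have "\<Union>C \<in> D"
        unfolding D_def
      proof (intro CollectI conjI ballI impI)
        show "\<Union>C \<subseteq> Z" using C by (auto simp: chains_def D_def)
        fix x y assume "x \<in> \<Union>C" "y \<in> \<Union>C" "x \<noteq> y"
        then obtain P Q where PQ: "P \<in> C" "Q \<in> C" "x \<in> P" "y \<in> Q" by blast
        then have "P \<subseteq> Q \<or> Q \<subseteq> P" using C by (auto simp: chains_def chain_subset_def)
        then obtain R where "R \<in> C" "x \<in> R" "y \<in> R" using PQ by blast
        moreover have "R \<in> D" using C \<open>R \<in> C\<close> by (auto simp: chains_def)
        ultimately show "a x \<inter> a y = {}" using \<open>x \<noteq> y\<close> unfolding D_def by blast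
      qed
      then show "\<exists>u\<in>D. \<forall>Y\<in>C. Y \<subseteq> u" by blast
    qed
    then obtain M where M: "M \<in> D" and max: "\<And>Y. Y \<in> D \<Longrightarrow> M \<subseteq> Y \<Longrightarrow> Y = M" by blast
    have "uncountable M"
    proof
      assume "countable M"
      moreover have "countable (a x)" if "x \<in> M" for x
        using that M Suc.prems(2) by (auto simp: D_def intro: countable_finite)
      ultimately have "countable (\<Union>(a ` M))" by blast
      then have cnt: "countable (M \<union> (\<Union>v\<in>\<Union>(a ` M). {x\<in>Z. v \<in> a x}))"
        using False \<open>countable M\<close> by blast
      have "Z \<subseteq> M \<union> (\<Union>v\<in>\<Union>(a ` M). {x\<in>Z. v \<in> a x})"
      proof
        fix x assume x: "x \<in> Z"
        show "x \<in> M \<union> (\<Union>v\<in>\<Union>(a ` M). {x\<in>Z. v \<in> a x})"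
        proof (rule ccontr)
          assume n: "\<not> ?thesis"
          with x M have "insert x M \<in> D" by (auto simp: D_def)
          then show False using max[of "insert x M"] n by blast
        qed
      qed
      from countable_subset[OF this cnt] show False using Suc.prems(1) by contradiction
    qed
    with M show ?thesis by (intro exI[of _ M] exI[of _ "{}"]) (simp add: D_def)
  qed
qed

lemma delta_system:
  fixes a :: "'i \<Rightarrow> 'a set"
  assumes "uncountable Z" and "\<And>x. x \<in> Z \<Longrightarrow> finite (a x)"
  obtains Y r where "Y \<subseteq> Z" "uncountable Y" "finite r"
    "\<And>x. x \<in> Y \<Longrightarrow> r \<subseteq> a x" "\<And>x y. x \<in> Y \<Longrightarrow> y \<in> Y \<Longrightarrow> x \<noteq> y \<Longrightarrow> a x \<inter> a y = r"
proof -
  obtain k where k: "uncountable {x\<in>Z. card (a x) = k}"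
    using uncountable_fibre[OF assms(1), of "\<lambda>x. card (a x)"] .
  obtain Y r where Y: "Y \<subseteq> {x\<in>Z. card (a x) = k}" "uncountable Y"
    and r: "\<And>x y. x \<in> Y \<Longrightarrow> y \<in> Y \<Longrightarrow> x \<noteq> y \<Longrightarrow> a x \<inter> a y = r"
    using delta_system_card[OF k, of a k] assms(2) by auto
  have other: "\<exists>y\<in>Y. x \<noteq> y" for x
  proof (rule ccontr)
    assume "\<not> ?thesis"
    then have "Y \<subseteq> {x}" by auto
    then show False using Y(2) countable_subset by blast
  qed
  have sub: "r \<subseteq> a x" if "x \<in> Y" for x
    using other[of x] r that by blast
  obtain x where "x \<in> Y" using other by blast
  then have "finite r" using sub[of x] Y(1) assms(2)[of x] finite_subset by auto
  moreover have "Y \<subseteq> Z" using Y(1) by auto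
  ultimately show ?thesis by (intro that[of Y r] Y(2) sub r)
qed

text \<open>The partition into the half-open squares of side \<open>\<delta> / 2\<close>.\<close>

lemma countable_partition_complex:
  fixes \<delta> :: real
  assumes "\<delta> > 0"
  obtains c :: "complex \<Rightarrow> int \<times> int" where "\<And>x y. c x = c y \<Longrightarrow> dist x y < \<delta>"
proof
  fix x y :: complex
  assume eq: "(\<lambda>x. (\<lfloor>2 * Re x / \<delta>\<rfloor>, \<lfloor>2 * Im x / \<delta>\<rfloor>)) x = (\<lambda>x. (\<lfloor>2 * Re x / \<delta>\<rfloor>, \<lfloor>2 * Im x / \<delta>\<rfloor>)) y"
  have *: "\<bar>u - v\<bar> < \<delta> / 2" if "\<lfloor>2 * u / \<delta>\<rfloor> = \<lfloor>2 * v / \<delta>\<rfloor>" for u v :: real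
  proof -
    have "\<bar>2 * u / \<delta> - 2 * v / \<delta>\<bar> < 1" using that by linarith
    then have "-1 < (2 * u - 2 * v) / \<delta>" "(2 * u - 2 * v) / \<delta> < 1" by (auto simp: diff_divide_distrib)
    then show ?thesis using assms by (cases "u \<le> v") (simp_all add: field_simps)
  qed
  have "dist x y \<le> \<bar>Re x - Re y\<bar> + \<bar>Im x - Im y\<bar>"
    using cmod_le[of "x - y"] by (simp add: dist_norm)
  also have "\<dots> < \<delta>" using *[of "Re x" "Re y"] *[of "Im x" "Im y"] eq by auto
  finally show "dist x y < \<delta>" .
qed

text \<open>A space that is not hereditarily Lindeloef contains a right separated \<open>\<omega>\<^sub>1\<close>-sequence: from a cover
  \<open>\<U>\<close> of a subspace without countable subcover, choose recursively a point outside the countably many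
  sets chosen so far, together with a member of \<open>\<U>\<close> around it.\<close>

lemma right_separated_sequence:
  assumes "\<not> hereditarily Lindelof_space \<tau>"
  obtains x :: "omega1 \<Rightarrow> 'a" and U :: "omega1 \<Rightarrow> 'a set"
  where "\<And>\<xi>. openin \<tau> (U \<xi>)" "\<And>\<xi>. x \<xi> \<in> U \<xi>" "\<And>\<xi> \<eta>. \<xi> < \<eta> \<Longrightarrow> x \<eta> \<notin> U \<xi>"
proof -
  obtain S where S: "S \<subseteq> topspace \<tau>" and "\<not> Lindelof_space (subtopology \<tau> S)"
    using assms unfolding hereditarily_def by metis
  then obtain \<U> where \<U>: "\<forall>u\<in>\<U>. openin (subtopology \<tau> S) u"
    and cov: "\<Union>\<U> = topspace (subtopology \<tau> S)"
    and nc: "\<not> (\<exists>\<V>. countable \<V> \<and> \<V> \<subseteq> \<U> \<and> \<Union>\<V> = topspace (subtopology \<tau> S))"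
    unfolding Lindelof_space_def not_all not_imp by (elim exE conjE)
  have tS: "topspace (subtopology \<tau> S) = S" using S by auto
  define good where "good f \<xi> p \<longleftrightarrow> fst p \<in> snd p \<and> snd p \<in> \<U> \<and> (\<forall>\<eta><\<xi>. fst p \<notin> snd (f \<eta>))"
    for f :: "omega1 \<Rightarrow> 'a \<times> 'a set" and \<xi> p
  have "\<exists>f. \<forall>\<xi>. good f \<xi> (f \<xi>)"
  proof (rule dependent_wellorder_choice)
    fix p :: "'a \<times> 'a set" and f g :: "omega1 \<Rightarrow> 'a \<times> 'a set" and \<xi>
    assume "\<And>\<eta>. \<eta> < \<xi> \<Longrightarrow> f \<eta> = g \<eta>"
    then show "good f \<xi> p = good g \<xi> p" by (auto simp: good_def)
  next
    fix \<xi> f assume IH: "\<And>\<eta>. \<eta> < \<xi> \<Longrightarrow> good f \<eta> (f \<eta>)"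
    define \<V> where "\<V> = (\<lambda>\<eta>. snd (f \<eta>)) ` {..<\<xi>}"
    have "countable \<V>" unfolding \<V>_def by (intro countable_image omega1_countable_lessThan)
    moreover have V: "\<V> \<subseteq> \<U>" using IH by (auto simp: \<V>_def good_def)
    ultimately have "\<Union>\<V> \<noteq> \<Union>\<U>" using nc cov by metis
    with V obtain y u where "y \<in> u" "u \<in> \<U>" "y \<notin> \<Union>\<V>" by blast
    then have "good f \<xi> (y, u)" by (auto simp: good_def \<V>_def)
    then show "\<exists>p. good f \<xi> p" ..
  qed
  then obtain f where f: "\<And>\<xi>. good f \<xi> (f \<xi>)" by blast
  have "\<exists>T. openin \<tau> T \<and> snd (f \<xi>) = T \<inter> S" for \<xi>
    using \<U> f[of \<xi>] by (auto simp: good_def openin_subtopology)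
  then obtain T where T: "\<And>\<xi>. openin \<tau> (T \<xi>)" "\<And>\<xi>. snd (f \<xi>) = T \<xi> \<inter> S" by metis
  have "fst (f \<xi>) \<in> S" for \<xi> using f[of \<xi>] T(2)[of \<xi>] by (auto simp: good_def)
  then have *: "fst (f \<xi>) \<in> T \<xi>" "\<eta> < \<xi> \<Longrightarrow> fst (f \<xi>) \<notin> T \<eta>" for \<xi> \<eta>
    using f[of \<xi>] by (auto simp: good_def T(2))
  show ?thesis by (rule that[of T "\<lambda>\<xi>. fst (f \<xi>)"]) (use T * in auto)
qed

section \<open>Kronecker approximation on a torus\<close>

text \<open>Kronecker's theorem for multiplicatively independent points of the circle. It follows from the
  additive theorem for angles \<open>\<theta>\<close>: as \<open>\<theta> \<mapsto> exp (2 \<pi> \<i> \<theta>)\<close> sends integers to \<open>1\<close>, an integer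
  linear relation among the angles and \<open>1\<close> becomes a multiplicative relation among the points.\<close>

lemma kronecker_circle:
  fixes z t :: "'i \<Rightarrow> complex"
  assumes "finite A" and z: "\<forall>i\<in>A. norm (z i) = 1" and t: "\<forall>i\<in>A. norm (t i) = 1"
    and indep: "\<forall>n :: 'i \<Rightarrow> int. (\<Prod>i\<in>A. z i powi n i) = 1 \<longrightarrow> (\<forall>i\<in>A. n i = 0)"
    and "\<epsilon> > 0"
  shows "\<exists>k :: int. \<forall>i\<in>A. dist (z i powi k) (t i) < \<epsilon>"
proof -
  define c where "c = card A"
  obtain g where g: "bij_betw g {..<c} A"
    using assms(1) c_def by (metis bij_betw_from_nat_into_finite)
  define E :: "real \<Rightarrow> complex" where "E u = exp (\<i> * of_real (2 * pi * u))" for u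
  have E_add: "E (u + v) = E u * E v" for u v
    by (simp add: E_def distrib_left exp_add of_real_add)
  have E_int: "E (of_int k) = 1" for k
    unfolding E_def
    by (metis (no_types, lifting) exp_integer_2pi Ints_of_int mult.assoc mult.commute
        of_real_mult of_real_of_int_eq)
  have E_powi: "E (of_int k * u) = E u powi k" for k u
    by (simp add: E_def exp_power_int mult_ac)
  have E_sum: "E (\<Sum>i\<in>S. f i) = (\<Prod>i\<in>S. E (f i))" if "finite S" for S :: "nat set" and f
    using that by (induction S) (auto simp: E_add, simp add: E_def)
  have E_surj: "\<exists>u. E u = w" if "norm w = 1" for w
  proof
    have "exp (\<i> * of_real (Arg w)) = w" using that cis_Arg[of w] norm_complex_def
      by (metis cis_conv_exp complex_norm_eq_1_exp_eq)
    then show "E (Arg w / (2 * pi)) = w" by (simp add: E_def)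
  qed
  have "\<forall>i\<in>A. \<exists>u. E u = z i" using E_surj z by blast
  then obtain \<theta>0 where \<theta>0: "\<And>i. i \<in> A \<Longrightarrow> E (\<theta>0 i) = z i" by metis
  have "\<forall>i\<in>A. \<exists>u. E u = t i" using E_surj t by blast
  then obtain \<tau> where \<tau>: "\<And>i. i \<in> A \<Longrightarrow> E (\<tau> i) = t i" by metis
  \<comment> \<open>Angles of the points of \<open>A\<close>, enumerated by \<open>g\<close>, with \<open>1\<close> appended at position \<open>c\<close>.\<close>
  define \<theta> where "\<theta> i = (if i < c then \<theta>0 (g i) else 1)" for i
  have gA: "g i \<in> A" if "i < c" for i using g that by (auto simp: bij_betw_def)
  have E\<theta>: "E (\<theta> i) = z (g i)" if "i < c" for i using that gA \<theta>0 by (simp add: \<theta>_def)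
  have rel: "\<forall>i\<le>c. m i = 0" if "(\<Sum>i\<le>c. of_int (m i) * \<theta> i) = 0" for m :: "nat \<Rightarrow> int"
  proof -
    have "(\<Sum>i<c. of_int (m i) * \<theta> i) + of_int (m c) = 0"
      using that by (simp add: lessThan_Suc_atMost[symmetric] \<theta>_def)
    then have "(\<Sum>i<c. of_int (m i) * \<theta> i) = of_int (- m c)" by simp
    then have "(\<Prod>i<c. z (g i) powi m i) = 1"
      using E_sum[of "{..<c}" "\<lambda>i. of_int (m i) * \<theta> i"] E_int[of "- m c"] by (simp add: E_powi E\<theta>)
    moreover have "(\<Prod>i\<in>A. z i powi m (inv_into {..<c} g i)) = (\<Prod>i<c. z (g i) powi m i)"
      using g by (simp add: prod.reindex_bij_betw[OF g, symmetric] bij_betw_def inv_into_f_f)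
    ultimately have "\<forall>i\<in>A. m (inv_into {..<c} g i) = 0"
      using spec[OF indep, of "\<lambda>i. m (inv_into {..<c} g i)"] by simp
    then have 0: "m i = 0" if "i < c" for i
      using that gA[OF that] g by (metis bij_betw_def inv_into_f_f lessThan_iff)
    then have "m c = 0" using that by (simp add: lessThan_Suc_atMost[symmetric] \<theta>_def)
    with 0 show ?thesis by (metis le_neq_implies_less)
  qed
  have inj: "inj_on \<theta> {..c}"
  proof (rule inj_onI, rule ccontr)
    fix i j assume ij: "i \<in> {..c}" "j \<in> {..c}" "\<theta> i = \<theta> j" "i \<noteq> j"
    have "(\<Sum>l\<le>c. of_int ((if l = i then 1 else 0) - (if l = j then 1 else 0)) * \<theta> l)
       = (\<Sum>l\<le>c. if l = i then \<theta> l else 0) - (\<Sum>l\<le>c. if l = j then \<theta> l else 0)"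
      by (subst sum_subtractf[symmetric], rule sum.cong) auto
    also have "\<dots> = 0" using ij by (simp add: sum.delta)
    finally show False
      using rel[of "\<lambda>l. (if l = i then 1 else 0) - (if l = j then 1 else 0)"] ij by fastforce
  qed
  interpret Modules.module "(\<lambda>r x. of_int r * (x::real))"
    by (simp add: Modules.module.intro distrib_left distrib_right mult.commute)
  have ind: "independent (\<theta> ` {..c})"
    using rel[of "\<lambda>i. f (\<theta> i)" for f] by (auto simp: dependent_finite sum.reindex[OF inj])
  have pos: "\<epsilon> / (2 * pi) > 0" using assms by simp
  obtain k m where km: "\<And>i. i < c \<Longrightarrow> \<bar>of_int k * \<theta> i - of_int (m i) - \<tau> (g i)\<bar> < \<epsilon> / (2 * pi)"
    by (rule Kronecker_thm_2[OF ind inj _ pos, of "\<lambda>i. \<tau> (g i)"]) (auto simp: \<theta>_def)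
  have "dist (z i powi k) (t i) < \<epsilon>" if "i \<in> A" for i
  proof -
    have "i \<in> g ` {..<c}" using that bij_betw_imp_surj_on[OF g] by simp
    then obtain j where j: "j < c" "i = g j" by blast
    define d where "d = of_int k * \<theta> j - of_int (m j) - \<tau> (g j)"
    have "of_int k * \<theta> j = d + (\<tau> i + of_int (m j))" by (simp add: d_def j)
    then have "z i powi k = E d * t i"
      using E_powi[of k "\<theta> j"] E\<theta>[OF j(1)] \<tau>[OF that] j by (simp add: E_add E_int)
    then have "dist (z i powi k) (t i) = norm ((E d - 1) * t i)"
      by (simp add: dist_norm algebra_simps)
    also have "\<dots> = norm (E d - 1)" using t that by (simp add: norm_mult)
    also have "\<dots> = 2 * \<bar>sin (2 * pi * d / 2)\<bar>" unfolding E_def by (rule dist_exp_i_1)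
    also have "\<dots> \<le> 2 * \<bar>2 * pi * d / 2\<bar>" using abs_sin_x_le_abs_x by simp
    also have "\<dots> = \<bar>d\<bar> * (2 * pi)" by (simp add: abs_mult)
    also have "\<dots> < \<epsilon>" using km[OF j(1)] by (simp add: d_def field_simps)
    finally show ?thesis .
  qed
  then show ?thesis by blast
qed

text \<open>By compactness of the torus the exponent can be bounded uniformly in the target \<open>t\<close>. With a finite
  \<open>\<epsilon> / 2\<close>-net, finitely many integer exponents suffice, say between \<open>- M\<close> and \<open>M\<close>; approximating
  \<open>t / z ^ M\<close> in place of \<open>t\<close> shifts them to natural numbers below \<open>2 * M + 1\<close>.

  The uniformity is essential: the number of sets \<open>b\<^sub>m\<close> requested from Moore's theorem has to be fixed
  before the coordinates and the target point are known.\<close>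

lemma kronecker_uniform:
  fixes z :: "'i \<Rightarrow> complex"
  assumes "finite A" and z: "\<forall>i\<in>A. norm (z i) = 1"
    and indep: "\<forall>n :: 'i \<Rightarrow> int. (\<Prod>i\<in>A. z i powi n i) = 1 \<longrightarrow> (\<forall>i\<in>A. n i = 0)"
    and "\<epsilon> > 0"
  shows "\<exists>N. \<forall>t. (\<forall>i\<in>A. norm (t i) = 1) \<longrightarrow> (\<exists>m<N. \<forall>i\<in>A. dist (z i ^ m) (t i) < \<epsilon>)"
proof -
  obtain G where G: "finite G" "G \<subseteq> sphere (0::complex) 1" "sphere 0 1 \<subseteq> (\<Union>x\<in>G. ball x (\<epsilon> / 2))"
  proof (rule compactE_image[OF compact_sphere, of "sphere 0 1" "\<lambda>x. ball x (\<epsilon> / 2)"])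
    show "sphere 0 1 \<subseteq> (\<Union>x\<in>sphere (0::complex) 1. ball x (\<epsilon> / 2))"
      using assms(4) by (auto intro!: exI)
  qed auto
  define P where "P = PiE A (\<lambda>_. G)"
  have P: "finite P" using assms(1) G(1) by (simp add: P_def finite_PiE)
  have "\<exists>k::int. \<forall>i\<in>A. dist (z i powi k) (p i) < \<epsilon> / 2" if "p \<in> P" for p
  proof -
    have "\<forall>i\<in>A. norm (p i) = 1"
      using \<open>p \<in> P\<close> G(2) by (auto simp: P_def PiE_iff)
    then show ?thesis
      by (rule kronecker_circle[OF assms(1) z _ indep]) (use assms(4) in simp)
  qed
  then obtain k :: "('i \<Rightarrow> complex) \<Rightarrow> int"
    where k: "\<And>p i. p \<in> P \<Longrightarrow> i \<in> A \<Longrightarrow> dist (z i powi k p) (p i) < \<epsilon> / 2" by metis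
  define M where "M = nat (\<Sum>p\<in>P. \<bar>k p\<bar>)"
  have M: "\<bar>k p\<bar> \<le> int M" if "p \<in> P" for p
    using member_le_sum[OF that, of "\<lambda>p. \<bar>k p\<bar>"] P by (simp add: M_def)
  show ?thesis
  proof (rule exI[of _ "2 * M + 1"], intro allI impI)
    fix t :: "'i \<Rightarrow> complex" assume t: "\<forall>i\<in>A. norm (t i) = 1"
    have "\<exists>y\<in>G. dist y (t i / z i ^ M) < \<epsilon> / 2" if "i \<in> A" for i
    proof -
      have "t i / z i ^ M \<in> sphere 0 1" using t z that by (simp add: norm_divide norm_power)
      then obtain w where "w \<in> G" "t i / z i ^ M \<in> ball w (\<epsilon> / 2)" using G(3) by blast
      then show ?thesis by (intro bexI[of _ w]) (auto simp: mem_ball)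
    qed
    then obtain y where y: "\<And>i. i \<in> A \<Longrightarrow> y i \<in> G \<and> dist (y i) (t i / z i ^ M) < \<epsilon> / 2" by metis
    define p where "p = restrict y A"
    have p: "p \<in> P" using y by (simp add: p_def P_def PiE_iff)
    \<comment> \<open>The net element \<open>p\<close> approximates \<open>t / z ^ M\<close>, whence the shift of its exponent by \<open>M\<close>.\<close>
    define m where "m = nat (k p + int M)"
    have m: "int m = k p + int M" "m < 2 * M + 1" using M[OF p] by (auto simp: m_def)
    have "dist (z i ^ m) (t i) < \<epsilon>" if "i \<in> A" for i
    proof -
      have z0: "z i \<noteq> 0" using bspec[OF z that] by auto
      have "z i ^ m = z i powi k p * z i ^ M"
        using m(1) z0 by (metis power_int_add power_int_of_nat)
      then have "dist (z i ^ m) (t i) = norm ((z i powi k p - t i / z i ^ M) * z i ^ M)"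
        using z0 by (simp add: dist_norm algebra_simps)
      also have "\<dots> = dist (z i powi k p) (t i / z i ^ M)"
        using bspec[OF z that] by (simp add: norm_mult norm_power dist_norm)
      also have "\<dots> \<le> dist (z i powi k p) (y i) + dist (y i) (t i / z i ^ M)" by (rule dist_triangle)
      also have "\<dots> < \<epsilon>" using k[OF p that] y[OF that] that by (simp add: p_def)
      finally show ?thesis .
    qed
    then show "\<exists>m<2 * M + 1. \<forall>i\<in>A. dist (z i ^ m) (t i) < \<epsilon>" using m(2) by blast
  qed
qed

section \<open>Subspaces and subsemigroups of the torus\<close>

lemma openin_subtopology_product_dist:
  fixes S :: "'b::metric_space set"
  assumes "openin (subtopology (product_topology (\<lambda>_. top_of_set S) X) H) U" "x \<in> U"
  shows "\<exists>K \<epsilon>. finite K \<and> K \<subseteq> X \<and> \<epsilon> > 0 \<and>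
    (\<forall>y \<in> H \<inter> (\<Pi>\<^sub>E i\<in>X. S). (\<forall>i\<in>K. dist (y i) (x i) < \<epsilon>) \<longrightarrow> y \<in> U)"
proof -
  obtain T where T: "openin (product_topology (\<lambda>_. top_of_set S) X) T" "U = T \<inter> H"
    using assms(1) by (auto simp: openin_subtopology)
  have "x \<in> T" using assms(2) T(2) by simp
  then obtain V where V: "finite {i\<in>X. V i \<noteq> S}" "\<forall>i\<in>X. openin (top_of_set S) (V i)"
      "x \<in> Pi\<^sub>E X V" "Pi\<^sub>E X V \<subseteq> T"
    using T(1) unfolding openin_product_topology_alt by fastforce
  define K where "K = {i\<in>X. V i \<noteq> S}"
  have "\<exists>e>0. \<forall>u\<in>S. dist u (x i) < e \<longrightarrow> u \<in> V i" if "i \<in> X" for i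
    using V(2,3) that by (auto simp: openin_euclidean_subtopology_iff PiE_iff)
  then obtain e where e: "\<And>i. i \<in> X \<Longrightarrow> e i > 0"
      "\<And>i u. i \<in> X \<Longrightarrow> u \<in> S \<Longrightarrow> dist u (x i) < e i \<Longrightarrow> u \<in> V i" by metis
  define \<epsilon> where "\<epsilon> = Min (insert 1 (e ` K))"
  have K: "finite K" "K \<subseteq> X" using V(1) by (auto simp: K_def)
  have \<epsilon>: "\<epsilon> > 0" "\<And>i. i \<in> K \<Longrightarrow> \<epsilon> \<le> e i"
    unfolding \<epsilon>_def using K e(1) by auto
  have "y \<in> U" if y: "y \<in> H \<inter> (\<Pi>\<^sub>E i\<in>X. S)" "\<forall>i\<in>K. dist (y i) (x i) < \<epsilon>" for y
  proof -
    have "y i \<in> V i" if i: "i \<in> X" for i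
    proof (cases "i \<in> K")
      case True
      then have "dist (y i) (x i) < e i" using y(2) \<epsilon>(2) by fastforce
      then show ?thesis using e(2)[OF i] y(1) i by (auto simp: PiE_iff)
    next
      case False
      then show ?thesis using y(1) i by (auto simp: PiE_iff K_def)
    qed
    then have "y \<in> Pi\<^sub>E X V" using y(1) by (auto simp: PiE_iff)
    then show ?thesis using V(4) T(2) y(1) by blast
  qed
  then show ?thesis using K \<epsilon>(1) by blast
qed

text \<open>The assumption \<open>A \<subseteq> carrier G\<close> is essential: if no subsemigroup contains \<open>A\<close>, then the hull of \<open>A\<close>
  is an intersection over the empty family, that is, the whole type.\<close>

lemma sgrp_subsemigroup:
  assumes "monoid G" "A \<subseteq> carrier G"
  shows "subsemigroup (sgrp G A) G"
proof -
  have "subsemigroup (carrier G) G"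
    using assms(1) by (simp add: subsemigroup_def monoid.m_closed)
  then have "sgrp G A \<subseteq> carrier G"
    unfolding sgrp_def using assms(2) by (intro hull_minimal)
  then show ?thesis
    by (auto simp: subsemigroup_def sgrp_def hull_def)
qed

lemma group_circle_group: "group circle_group"
proof (rule groupI)
  fix x assume x: "x \<in> carrier circle_group"
  then have "x \<noteq> 0" by (auto simp: circle_group_def)
  with x show "\<exists>y\<in>carrier circle_group. y \<otimes>\<^bsub>circle_group\<^esub> x = \<one>\<^bsub>circle_group\<^esub>"
    by (intro bexI[of _ "inverse x"]) (auto simp: circle_group_def norm_inverse)
qed (auto simp: circle_group_def norm_mult)

lemma group_torus_group: "group (torus_group X)"
  by (simp add: torus_group_def group_circle_group)

lemma carrier_torus_group: "carrier (torus_group X) = (\<Pi>\<^sub>E i\<in>X. sphere 0 1)"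
  by (simp add: torus_group_def circle_group_def)

lemma mult_torus_group: "x \<otimes>\<^bsub>torus_group X\<^esub> y = (\<lambda>i\<in>X. x i * y i)"
  by (simp add: torus_group_def circle_group_def)

lemma topspace_torus_topology: "topspace (torus_topology X) = (\<Pi>\<^sub>E i\<in>X. sphere 0 1)"
  by (simp add: torus_topology_def)

lemma continuous_map_torus_mult:
  "continuous_map (prod_topology (torus_topology X) (torus_topology X)) (torus_topology X)
     (\<lambda>(x, y). x \<otimes>\<^bsub>torus_group X\<^esub> y)"
proof -
  let ?S = "sphere (0::complex) 1"
  let ?P = "prod_topology (torus_topology X) (torus_topology X)"
  have "continuous_map ?P (top_of_set ?S) (\<lambda>p. fst p i * snd p i)" if i: "i \<in> X" for i
  proof -
    have c: "continuous_map (torus_topology X) (top_of_set ?S) (\<lambda>x. x i)"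
      unfolding torus_topology_def by (rule continuous_map_product_projection[OF i])
    have pair: "continuous_map ?P (prod_topology (top_of_set ?S) (top_of_set ?S)) (\<lambda>p. (fst p i, snd p i))"
      unfolding continuous_map_pairwise
      using continuous_map_compose[OF continuous_map_fst[of "torus_topology X" "torus_topology X"] c]
        continuous_map_compose[OF continuous_map_snd[of "torus_topology X" "torus_topology X"] c]
      by (simp add: o_def)
    have mul: "continuous_map (prod_topology (top_of_set ?S) (top_of_set ?S)) (top_of_set ?S)
        (\<lambda>q. fst q * snd q)"
      unfolding prod_topology_subtopology_eu
      by (auto simp: continuous_map_in_subtopology norm_mult continuous_map_iff_continuous2 intro!: continuous_intros)
    show ?thesis
      using continuous_map_compose[OF pair mul] by (simp add: o_def)
  qed
  then have "continuous_map ?P (product_topology (\<lambda>_. top_of_set ?S) X) (\<lambda>p. \<lambda>i\<in>X. fst p i * snd p i)"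
    unfolding continuous_map_componentwise by auto
  then show ?thesis by (simp add: mult_torus_group case_prod_unfold torus_topology_def)
qed

lemma topological_semigroup_torus:
  assumes "subsemigroup H (torus_group X)"
  shows "topological_semigroup (subtopology (torus_topology X) H) (mult (torus_group X))"
proof -
  have H: "H \<subseteq> carrier (torus_group X)" and cl: "\<And>x y. x \<in> H \<Longrightarrow> y \<in> H \<Longrightarrow> x \<otimes>\<^bsub>torus_group X\<^esub> y \<in> H"
    using assms by (auto simp: subsemigroup_def)
  have top: "topspace (subtopology (torus_topology X) H) = H"
    using H by (auto simp: topspace_torus_topology carrier_torus_group)
  interpret group "torus_group X" by (rule group_torus_group)
  have "continuous_map (subtopology (prod_topology (torus_topology X) (torus_topology X)) (H \<times> H))
      (subtopology (torus_topology X) H) (\<lambda>(x, y). x \<otimes>\<^bsub>torus_group X\<^esub> y)"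
    using continuous_map_torus_mult cl
    by (auto simp: continuous_map_in_subtopology continuous_map_from_subtopology)
  moreover have "prod_topology (subtopology (torus_topology X) H) (subtopology (torus_topology X) H) =
      subtopology (prod_topology (torus_topology X) (torus_topology X)) (H \<times> H)"
    by (simp add: subtopology_Times)
  ultimately show ?thesis
    unfolding topological_semigroup_def top using cl H by (auto simp: m_assoc subset_iff)
qed

lemma cancellative_subsemigroup:
  assumes "group G" "subsemigroup H G"
  shows "cancellative G H"
proof -
  interpret group G by fact
  show ?thesis using assms(2) by (auto simp: cancellative_def subsemigroup_def subset_iff)
qed

lemma regular_t1_torus_subspace:
  "regular_space (subtopology (torus_topology X) H)" "t1_space (subtopology (torus_topology X) H)"
proof -
  have m: "metrizable_space (top_of_set (sphere (0::complex) 1))"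
    by (simp add: metrizable_space_euclidean metrizable_space_subtopology)
  show "regular_space (subtopology (torus_topology X) H)"
    unfolding torus_topology_def
    by (intro regular_space_subtopology) (simp add: regular_space_product_topology m metrizable_imp_regular_space)
  show "t1_space (subtopology (torus_topology X) H)"
    unfolding torus_topology_def
    by (intro t1_space_subtopology) (simp add: t1_space_product_topology m metrizable_imp_t1_space)
qed

section \<open>Products of the points w\<close>

definition w_prod ::
  "(omega1 \<Rightarrow> omega1 \<Rightarrow> nat) \<Rightarrow> (omega1 \<Rightarrow> omega1 \<Rightarrow> omega1 set) \<Rightarrow> (omega1 \<Rightarrow> complex) \<Rightarrow>
   (omega1 \<Rightarrow> nat) \<Rightarrow> omega1 set \<Rightarrow> omega1 \<Rightarrow> complex" where
  "w_prod e L z n F \<alpha> = (\<Prod>\<beta>\<in>F. w_point e L z \<beta> \<alpha> ^ n \<beta>)"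

lemma norm_w_point: "norm (z \<alpha>) = 1 \<Longrightarrow> norm (w_point e L z \<beta> \<alpha>) = 1"
  by (simp add: w_point_def norm_mult norm_power)

lemma norm_w_prod: "norm (z \<alpha>) = 1 \<Longrightarrow> norm (w_prod e L z n F \<alpha>) = 1"
  by (simp add: w_prod_def norm_power norm_w_point flip: prod_norm)

text \<open>The index set may be enlarged by points of multiplicity \<open>0\<close>. This is what allows one finite set
  to carry a product, a neighbourhood and an index at the same time.\<close>

lemma w_prod_superset:
  assumes "finite G" "F \<subseteq> G" "\<And>\<beta>. \<beta> \<in> G - F \<Longrightarrow> n \<beta> = 0"
  shows "w_prod e L z n G = w_prod e L z n F"
  unfolding w_prod_def fun_eq_iff using assms by (auto intro!: prod.mono_neutral_right)

text \<open>The products of powers of the \<open>w\<^sub>\<beta>\<close> form a subsemigroup: over the union of the two index sets, multiplying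
  means adding multiplicities. The convention \<open>n \<beta> = 0\<close> off \<open>F\<close> is what makes this possible.\<close>

lemma sgrp_L_set_cases:
  assumes "\<forall>\<alpha>. z \<alpha> \<in> sphere 0 1" and "h \<in> sgrp (torus_group X) (L_set e L z X)"
  obtains F n where "finite F" "F \<subseteq> X" "\<And>\<beta>. \<beta> \<notin> F \<Longrightarrow> n \<beta> = 0" "h = restrict (w_prod e L z n F) X"
proof -
  define W where "W = {restrict (w_prod e L z n F) X | n F.
    finite F \<and> F \<subseteq> X \<and> (\<forall>\<beta>. \<beta> \<notin> F \<longrightarrow> n \<beta> = 0)}"
  have "L_set e L z X \<subseteq> W"
  proof
    fix h assume "h \<in> L_set e L z X"
    then obtain \<beta> where "\<beta> \<in> X" "h = restrict (w_point e L z \<beta>) X" by (auto simp: L_set_def)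
    moreover have "w_prod e L z (\<lambda>\<gamma>. if \<gamma> = \<beta> then 1 else 0) {\<beta>} = w_point e L z \<beta>"
      by (simp add: fun_eq_iff w_prod_def)
    ultimately show "h \<in> W"
      unfolding W_def by (intro CollectI exI[of _ "\<lambda>\<gamma>. if \<gamma> = \<beta> then 1 else 0"] exI[of _ "{\<beta>}"]) auto
  qed
  moreover have "subsemigroup W (torus_group X)"
    unfolding subsemigroup_def
  proof (intro conjI ballI)
    show "W \<subseteq> carrier (torus_group X)"
      using assms(1) by (auto simp: W_def carrier_torus_group norm_w_prod)
    fix x y assume "x \<in> W" "y \<in> W"
    then obtain m F n G where x: "x = restrict (w_prod e L z m F) X" "finite F" "F \<subseteq> X" "\<forall>\<beta>. \<beta> \<notin> F \<longrightarrow> m \<beta> = 0"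
      and y: "y = restrict (w_prod e L z n G) X" "finite G" "G \<subseteq> X" "\<forall>\<beta>. \<beta> \<notin> G \<longrightarrow> n \<beta> = 0"
      unfolding W_def by blast
    have "w_prod e L z m (F \<union> G) = w_prod e L z m F" "w_prod e L z n (F \<union> G) = w_prod e L z n G"
      using x y by (auto intro!: w_prod_superset)
    moreover have "w_prod e L z (\<lambda>\<beta>. m \<beta> + n \<beta>) (F \<union> G) \<alpha> = w_prod e L z m (F \<union> G) \<alpha> * w_prod e L z n (F \<union> G) \<alpha>" for \<alpha>
      by (simp add: w_prod_def power_add prod.distrib)
    ultimately have "x \<otimes>\<^bsub>torus_group X\<^esub> y = restrict (w_prod e L z (\<lambda>\<beta>. m \<beta> + n \<beta>) (F \<union> G)) X"
      by (auto simp: mult_torus_group x(1) y(1) fun_eq_iff)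
    then show "x \<otimes>\<^bsub>torus_group X\<^esub> y \<in> W"
      unfolding W_def using x(2-4) y(2-4)
      by (intro CollectI exI[of _ "\<lambda>\<beta>. m \<beta> + n \<beta>"] exI[of _ "F \<union> G"]) auto
  qed
  ultimately have "sgrp (torus_group X) (L_set e L z X) \<subseteq> W"
    unfolding sgrp_def by (rule hull_minimal)
  with assms(2) show ?thesis using that unfolding W_def by blast
qed

lemma L_set_subset_carrier:
  assumes "\<forall>\<alpha>. z \<alpha> \<in> sphere 0 1"
  shows "L_set e L z X \<subseteq> carrier (torus_group X)"
  using assms by (auto simp: L_set_def carrier_torus_group norm_w_point)

text \<open>Independence of the powers \<open>z \<alpha> ^ N\<close>, in the form required by Kronecker's theorem.\<close>

lemma rationally_independent_power:
  assumes "rationally_independent z" "0 < N" "finite A"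
  shows "\<forall>n :: omega1 \<Rightarrow> int. (\<Prod>\<alpha>\<in>A. (z \<alpha> ^ N) powi n \<alpha>) = 1 \<longrightarrow> (\<forall>\<alpha>\<in>A. n \<alpha> = 0)"
proof (intro allI impI ballI)
  fix n :: "omega1 \<Rightarrow> int" and \<alpha> assume 1: "(\<Prod>\<alpha>\<in>A. (z \<alpha> ^ N) powi n \<alpha>) = 1" and "\<alpha> \<in> A"
  have "(\<Prod>\<alpha>\<in>A. (z \<alpha> ^ N) powi n \<alpha>) = (\<Prod>\<alpha>\<in>A. z \<alpha> powi (int N * n \<alpha>))"
    by (simp add: power_int_mult)
  with 1 assms(1,3) \<open>\<alpha> \<in> A\<close> have "int N * n \<alpha> = 0"
    unfolding rationally_independent_def by metis
  with assms(2) show "n \<alpha> = 0" by simp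
qed

lemma rationally_independent_power_neq_1:
  assumes "rationally_independent z" "0 < N"
  shows "z \<alpha> ^ N \<noteq> 1"
  using rationally_independent_power[OF assms, of "{\<alpha>}"] by (auto dest: spec[of _ "\<lambda>_. 1"])

text \<open>Every element of the semigroup has value \<open>1\<close> at all but countably many coordinates, since
  \<open>w\<^sub>\<beta>(\<alpha>) = 1\<close> for \<open>\<alpha> \<ge> \<beta>\<close>. So all elements of a countable set have value \<open>1\<close> at a common coordinate
  \<open>\<alpha>\<close>, and so does their closure; but \<open>w\<^sub>\<beta>(\<alpha>) \<noteq> 1\<close> for each \<open>\<beta> > \<alpha>\<close>.\<close>

lemma not_separable_sgrp_L_set:
  assumes z: "\<forall>\<alpha>. z \<alpha> \<in> sphere 0 1" and ind: "rationally_independent z" and X: "uncountable X"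
  shows "\<not> separable_space (subtopology (torus_topology X) (sgrp (torus_group X) (L_set e L z X)))"
proof
  define H where "H = sgrp (torus_group X) (L_set e L z X)"
  let ?T = "subtopology (torus_topology X) H"
  have LH: "L_set e L z X \<subseteq> H" unfolding H_def sgrp_def by (rule hull_subset)
  have "H \<subseteq> carrier (torus_group X)"
    using sgrp_subsemigroup[OF _ L_set_subset_carrier[OF z]] group_torus_group
    unfolding H_def subsemigroup_def by (metis group.is_monoid)
  then have top: "topspace ?T = H"
    by (auto simp: topspace_torus_topology carrier_torus_group)
  assume "separable_space (subtopology (torus_topology X) (sgrp (torus_group X) (L_set e L z X)))"
  then obtain C where C: "countable C" "C \<subseteq> H" "?T closure_of C = H"
    unfolding separable_space_def H_def[symmetric] top by blast
  have cnt: "countable {\<alpha>\<in>X. h \<alpha> \<noteq> 1}" if h: "h \<in> H" for h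
  proof -
    obtain F n where F: "finite F" "h = restrict (w_prod e L z n F) X"
      using sgrp_L_set_cases[OF z h[unfolded H_def]] by metis
    have "{\<alpha>\<in>X. h \<alpha> \<noteq> 1} \<subseteq> (\<Union>\<beta>\<in>F. {..<\<beta>})"
    proof
      fix \<alpha> assume \<alpha>: "\<alpha> \<in> {\<alpha>\<in>X. h \<alpha> \<noteq> 1}"
      show "\<alpha> \<in> (\<Union>\<beta>\<in>F. {..<\<beta>})"
      proof (rule ccontr)
        assume "\<not> ?thesis"
        then have "w_point e L z \<beta> \<alpha> = 1" if "\<beta> \<in> F" for \<beta>
          using that by (auto simp: w_point_def)
        then have "h \<alpha> = 1" using \<alpha> by (simp add: F w_prod_def)
        with \<alpha> show False by simp
      qed
    qed
    moreover have "countable (\<Union>\<beta>\<in>F. {..<\<beta>})"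
      using F(1) omega1_countable_lessThan by (intro countable_UN) (auto intro: countable_finite)
    ultimately show ?thesis by (rule countable_subset)
  qed
  have "countable (\<Union>h\<in>C. {\<alpha>\<in>X. h \<alpha> \<noteq> 1})"
    by (rule countable_UN[OF C(1)], rule cnt) (rule subsetD[OF C(2)])
  then have "\<not> X \<subseteq> (\<Union>h\<in>C. {\<alpha>\<in>X. h \<alpha> \<noteq> 1})"
    using X countable_subset[of X] by blast
  then obtain \<alpha> where \<alpha>: "\<alpha> \<in> X" "\<And>h. h \<in> C \<Longrightarrow> h \<alpha> = 1" by auto
  have "{..\<alpha>} = insert \<alpha> {..<\<alpha>}" by auto
  then have "countable {..\<alpha>}" using omega1_countable_lessThan by simp
  then have "\<not> X \<subseteq> {..\<alpha>}" using X countable_subset[of X] by blast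
  then obtain \<beta> where \<beta>: "\<beta> \<in> X" "\<alpha> < \<beta>" by (auto simp: subset_iff not_le)
  have cont: "continuous_map ?T euclidean (\<lambda>h. h \<alpha>)"
    using continuous_map_product_projection[OF \<alpha>(1), of "\<lambda>_. top_of_set (sphere (0::complex) 1)"]
    by (auto simp: torus_topology_def continuous_map_in_subtopology intro: continuous_map_from_subtopology)
  have clo: "closedin ?T {h \<in> topspace ?T. h \<alpha> \<in> {1}}"
    by (rule closedin_continuous_map_preimage[OF cont]) simp
  have sub: "C \<subseteq> {h \<in> topspace ?T. h \<alpha> \<in> {1}}" using C(2) \<alpha>(2) unfolding top by auto
  have "H \<subseteq> {h \<in> topspace ?T. h \<alpha> \<in> {1}}"
    using closure_of_minimal[OF sub clo] unfolding C(3) .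
  moreover have "restrict (w_point e L z \<beta>) X \<in> H" using LH \<beta>(1) by (auto simp: L_set_def)
  ultimately have "restrict (w_point e L z \<beta>) X \<in> {h \<in> topspace ?T. h \<alpha> \<in> {1}}" by (rule subsetD)
  then have "w_point e L z \<beta> \<alpha> = 1" using \<alpha>(1) unfolding mem_Collect_eq by simp
  then show False
    using rationally_independent_power_neq_1[OF ind, of "osc e L \<alpha> \<beta> + 1" \<alpha>] \<beta>(2) by (simp add: w_point_def)
qed

text \<open>If the oscillations of \<open>\<alpha>\<close> against the elements of \<open>B\<close> are \<open>m\<close> larger than some reference values \<open>p\<close>,
  then every factor \<open>w\<^sub>\<beta>(\<alpha>)\<close> gains \<open>z\<^sub>\<alpha>\<^sup>m\<close>, and the product gains the \<open>m\<close>-th power of \<open>z\<^sub>\<alpha>\<^sup>S\<close>, where \<open>S\<close> is the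
  sum of the multiplicities.\<close>

lemma w_prod_shift:
  assumes "finite B" "length (sorted_list_of_set B) = k" and less: "\<And>\<beta>. \<beta> \<in> B \<Longrightarrow> \<alpha> < \<beta>"
    and osc: "\<And>j. j < k \<Longrightarrow> osc e L \<alpha> (sorted_list_of_set B ! j) = p j + m"
  shows "w_prod e L z n B \<alpha> =
    (\<Prod>j<k. (z \<alpha> ^ (p j + 1)) ^ (map n (sorted_list_of_set B) ! j)) *
    (z \<alpha> ^ sum_list (map n (sorted_list_of_set B))) ^ m"
proof -
  define xs where "xs = sorted_list_of_set B"
  define N where "N = map n xs"
  have len: "length xs = k" "length N = k" using assms(2) by (auto simp: xs_def N_def)
  have bij: "bij_betw ((!) xs) {..<k} B"
    using assms(1) len unfolding xs_def by (intro bij_betw_nth) auto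
  have factor: "w_point e L z (xs ! j) \<alpha> ^ n (xs ! j) =
      (z \<alpha> ^ (p j + 1)) ^ (N ! j) * (z \<alpha> ^ m) ^ (N ! j)" if j: "j < k" for j
  proof -
    have "xs ! j \<in> B" using bij j by (auto simp: bij_betw_def)
    then have "\<alpha> < xs ! j" by (rule less)
    moreover have "n (xs ! j) = N ! j" using j len by (simp add: N_def)
    ultimately show ?thesis
      using osc[OF j] by (simp add: w_point_def xs_def power_add power_mult_distrib mult_ac)
  qed
  have "w_prod e L z n B \<alpha> = (\<Prod>j<k. w_point e L z (xs ! j) \<alpha> ^ n (xs ! j))"
    unfolding w_prod_def by (rule prod.reindex_bij_betw[OF bij, symmetric])
  also have "\<dots> = (\<Prod>j<k. (z \<alpha> ^ (p j + 1)) ^ (N ! j)) * (\<Prod>j<k. (z \<alpha> ^ m) ^ (N ! j))"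
    using factor by (simp add: prod.distrib)
  also have "(\<Prod>j<k. (z \<alpha> ^ m) ^ (N ! j)) = (z \<alpha> ^ m) ^ sum_list N"
    by (simp add: len sum_list_sum_nth power_sum atLeast0LessThan)
  also have "\<dots> = (z \<alpha> ^ sum_list N) ^ m" by (metis power_mult mult.commute)
  finally show ?thesis by (simp add: N_def xs_def)
qed

section \<open>The hereditary Lindeloef property\<close>

text \<open>Given a right separated sequence of points \<open>x \<xi>\<close> with neighbourhoods \<open>U \<xi>\<close>, the proof finds
  \<open>\<xi> < \<eta>\<close> with \<open>x \<eta> \<in> U \<xi>\<close>. Only indices \<open>\<xi> \<in> X\<close> are used, so that \<open>\<xi>\<close> itself is an admissible
  coordinate. One finite set \<open>a \<xi> \<subseteq> X\<close> contains \<open>\<xi>\<close>, the indices of the factors of \<open>x \<xi>\<close> and the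
  coordinates on which \<open>U \<xi>\<close> depends. After passing to a \<open>\<Delta>\<close>-system with root \<open>r\<close>, Moore's theorem is
  applied with the sets \<open>b \<xi> = a \<xi> - r\<close> in both roles. Because \<open>\<xi> \<in> b \<xi>\<close>, its conclusion \<open>b \<xi> < b \<eta>\<close>
  already contains \<open>\<xi> < \<eta>\<close>.\<close>

lemma hereditarily_Lindelof_sgrp_L_set:
  assumes moore: "moore_property (osc e L)" and z: "\<forall>\<alpha>. z \<alpha> \<in> sphere 0 1"
    and ind: "rationally_independent z" and X: "uncountable X"
  shows "hereditarily Lindelof_space (subtopology (torus_topology X) (sgrp (torus_group X) (L_set e L z X)))"
proof (rule ccontr)
  define H where "H = sgrp (torus_group X) (L_set e L z X)"
  let ?T = "subtopology (torus_topology X) H"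
  let ?l = "sorted_list_of_set :: omega1 set \<Rightarrow> omega1 list"
  have z1: "norm (z \<alpha>) = 1" for \<alpha> using z by simp
  assume "\<not> hereditarily Lindelof_space (subtopology (torus_topology X) (sgrp (torus_group X) (L_set e L z X)))"
  then obtain x :: "omega1 \<Rightarrow> omega1 \<Rightarrow> complex" and U where opU: "\<And>\<xi>. openin ?T (U \<xi>)"
    and xU: "\<And>\<xi>. x \<xi> \<in> U \<xi>" and right: "\<And>\<xi> \<eta>. \<xi> < \<eta> \<Longrightarrow> x \<eta> \<notin> U \<xi>"
    unfolding H_def[symmetric] by (rule right_separated_sequence) blast
  have xH: "x \<xi> \<in> H \<inter> (\<Pi>\<^sub>E i\<in>X. sphere 0 1)" for \<xi>
    using openin_subset[OF opU] xU[of \<xi>] by (auto simp: topspace_torus_topology)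
  have "\<exists>F n. finite F \<and> F \<subseteq> X \<and> (\<forall>\<beta>. \<beta> \<notin> F \<longrightarrow> n \<beta> = 0) \<and> x \<xi> = restrict (w_prod e L z n F) X" for \<xi>
    using sgrp_L_set_cases[OF z, of "x \<xi>" X e L] xH[of \<xi>] unfolding H_def by (metis IntD1)
  then obtain F n where F: "\<And>\<xi>. finite (F \<xi>)" "\<And>\<xi>. F \<xi> \<subseteq> X"
    and n: "\<And>\<xi> \<beta>. \<beta> \<notin> F \<xi> \<Longrightarrow> n \<xi> \<beta> = 0"
    and x: "\<And>\<xi>. x \<xi> = restrict (w_prod e L z (n \<xi>) (F \<xi>)) X" by metis
  have "\<exists>K q. finite K \<and> K \<subseteq> X \<and>
      (\<forall>y \<in> H \<inter> (\<Pi>\<^sub>E i\<in>X. sphere 0 1). (\<forall>i\<in>K. dist (y i) (x \<xi> i) < inverse (real (Suc q))) \<longrightarrow> y \<in> U \<xi>)" for \<xi>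
  proof -
    obtain K \<epsilon> where K: "finite K" "K \<subseteq> X" "\<epsilon> > 0"
      "\<forall>y \<in> H \<inter> (\<Pi>\<^sub>E i\<in>X. sphere 0 1). (\<forall>i\<in>K. dist (y i) (x \<xi> i) < \<epsilon>) \<longrightarrow> y \<in> U \<xi>"
      using openin_subtopology_product_dist[OF opU[unfolded torus_topology_def] xU] by metis
    obtain q where "inverse (real (Suc q)) < \<epsilon>" using reals_Archimedean[OF K(3)] by blast
    then have "\<forall>y \<in> H \<inter> (\<Pi>\<^sub>E i\<in>X. sphere 0 1).
        (\<forall>i\<in>K. dist (y i) (x \<xi> i) < inverse (real (Suc q))) \<longrightarrow> y \<in> U \<xi>"
      using K(4) by (meson less_trans)
    with K(1,2) show ?thesis by blast
  qed
  then obtain K q where K: "\<And>\<xi>. finite (K \<xi>)" "\<And>\<xi>. K \<xi> \<subseteq> X"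
    and KU: "\<And>\<xi> y. y \<in> H \<inter> (\<Pi>\<^sub>E i\<in>X. sphere 0 1) \<Longrightarrow>
      (\<forall>i\<in>K \<xi>. dist (y i) (x \<xi> i) < inverse (real (Suc (q \<xi>)))) \<Longrightarrow> y \<in> U \<xi>" by metis
  define a where "a \<xi> = insert \<xi> (F \<xi> \<union> K \<xi>)" for \<xi>
  have fa: "finite (a \<xi>)" for \<xi> using F K by (simp add: a_def)
  obtain Y r where Y: "Y \<subseteq> X" "uncountable Y" and r: "finite r"
    "\<And>\<xi>. \<xi> \<in> Y \<Longrightarrow> r \<subseteq> a \<xi>" "\<And>\<xi> \<eta>. \<xi> \<in> Y \<Longrightarrow> \<eta> \<in> Y \<Longrightarrow> \<xi> \<noteq> \<eta> \<Longrightarrow> a \<xi> \<inter> a \<eta> = r"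
    using delta_system[OF X, of a] fa by metis
  \<comment> \<open>Indices in the root would not belong to their own set \<open>b \<xi>\<close>; there are finitely many of them.\<close>
  define Z where "Z = Y - r"
  have Z: "uncountable Z" unfolding Z_def using Y(2) r(1) by (simp add: uncountable_minus_countable countable_finite)
  have ZD: "\<xi> \<in> Y" "\<xi> \<in> X" "\<xi> \<notin> r" if "\<xi> \<in> Z" for \<xi> using that Y by (auto simp: Z_def)
  define b where "b \<xi> = a \<xi> - r" for \<xi>
  have fb: "finite (b \<xi>)" for \<xi> using fa by (simp add: b_def)
  have own: "\<xi> \<in> b \<xi>" if "\<xi> \<in> Z" for \<xi> using ZD[OF that] by (simp add: b_def a_def)
  have bX: "b \<xi> \<subseteq> X" "r \<subseteq> X" if "\<xi> \<in> Z" for \<xi>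
    using ZD[OF that] F(2)[of \<xi>] K(2)[of \<xi>] r(2)[of \<xi>] by (auto simp: b_def a_def)
  have disj: "b \<xi> \<inter> b \<eta> = {}" if "\<xi> \<in> Z" "\<eta> \<in> Z" "\<xi> \<noteq> \<eta>" for \<xi> \<eta>
    using r(3)[OF ZD(1)[OF that(1)] ZD(1)[OF that(2)] that(3)] by (auto simp: b_def)
  \<comment> \<open>The root contributes a factor that will not depend on \<open>\<xi>\<close>; Moore's theorem controls the other one.\<close>
  have split: "x \<xi> \<alpha> = w_prod e L z (n \<xi>) r \<alpha> * w_prod e L z (n \<xi>) (b \<xi>) \<alpha>"
    if "\<xi> \<in> Z" "\<alpha> \<in> X" for \<xi> \<alpha>
  proof -
    have "w_prod e L z (n \<xi>) (a \<xi>) = w_prod e L z (n \<xi>) (F \<xi>)"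
      using fa n by (intro w_prod_superset) (auto simp: a_def)
    moreover have "a \<xi> = r \<union> b \<xi>" "r \<inter> b \<xi> = {}" using r(2)[OF ZD(1)[OF that(1)]] by (auto simp: b_def)
    ultimately show ?thesis
      using that(2) r(1) fb by (simp add: x w_prod_def prod.union_disjoint fun_eq_iff)
  qed
  define N where "N \<xi> = map (n \<xi>) (?l (b \<xi>))" for \<xi>
  \<comment> \<open>\<open>i\<close> sets from Moore's theorem suffice to come close to any target on \<open>b \<xi>\<close>.\<close>
  define apx where "apx \<xi> i \<longleftrightarrow> (\<forall>t. (\<forall>\<alpha>\<in>b \<xi>. norm (t \<alpha>) = 1) \<longrightarrow>
      (\<exists>m<i. \<forall>\<alpha>\<in>b \<xi>. dist ((z \<alpha> ^ sum_list (N \<xi>)) ^ m) (t \<alpha>) < inverse (real (Suc (q \<xi>)))))" for \<xi> i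
  have "\<exists>i. apx \<xi> i" if "0 < sum_list (N \<xi>)" for \<xi>
    using kronecker_uniform[OF fb _ rationally_independent_power[OF ind that fb], of \<xi> "inverse (real (Suc (q \<xi>)))"]
    by (simp add: norm_power z1 apx_def)
  then obtain s where s: "\<And>\<xi>. 0 < sum_list (N \<xi>) \<Longrightarrow> apx \<xi> (s \<xi>)" by metis
  have "\<exists>c :: complex \<Rightarrow> int \<times> int. \<forall>u v. c u = c v \<longrightarrow> dist u v < inverse (real (Suc i))" for i
    by (rule countable_partition_complex[of "inverse (real (Suc i))"]) auto
  then obtain c :: "nat \<Rightarrow> complex \<Rightarrow> int \<times> int"
    where c: "\<And>i u v. c i u = c i v \<Longrightarrow> dist u v < inverse (real (Suc i))" by metis
  \<comment> \<open>A countable type of invariants: after thinning out, multiplicities, radii and numbers of requested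
    sets are constant, and the points are close to each other on the root coordinates.\<close>
  define data where "data \<xi> = ((map (n \<xi>) (?l r), N \<xi>), (q \<xi>, s \<xi>), map (\<lambda>\<alpha>. c (q \<xi>) (x \<xi> \<alpha>)) (?l r))" for \<xi>
  obtain d where unc: "uncountable {\<xi>\<in>Z. data \<xi> = d}" using uncountable_fibre[OF Z, of data] .
  define V where "V = {\<xi>\<in>Z. data \<xi> = d}"
  have V: "uncountable V" "V \<subseteq> Z" using unc by (auto simp: V_def)
  have same: "data \<xi> = data \<eta>" if "\<xi> \<in> V" "\<eta> \<in> V" for \<xi> \<eta> using that by (simp add: V_def)
  have eqs: "N \<xi> = N \<eta>" "q \<xi> = q \<eta>" "s \<xi> = s \<eta>" if "\<xi> \<in> V" "\<eta> \<in> V" for \<xi> \<eta>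
    using same[OF that] by (auto simp: data_def)
  have nr: "n \<xi> \<beta> = n \<eta> \<beta>" if "\<xi> \<in> V" "\<eta> \<in> V" "\<beta> \<in> r" for \<xi> \<eta> \<beta>
    using same[OF that(1,2)] that(3) r(1) by (simp add: data_def)
  have wr: "w_prod e L z (n \<xi>) r = w_prod e L z (n \<eta>) r" if "\<xi> \<in> V" "\<eta> \<in> V" for \<xi> \<eta>
    using nr[OF that] by (simp add: w_prod_def fun_eq_iff)
  have near: "dist (x \<eta> \<alpha>) (x \<xi> \<alpha>) < inverse (real (Suc (q \<xi>)))" if "\<xi> \<in> V" "\<eta> \<in> V" "\<alpha> \<in> r" for \<xi> \<eta> \<alpha>
  proof (rule c)
    have "map (\<lambda>\<alpha>. c (q \<eta>) (x \<eta> \<alpha>)) (?l r) = map (\<lambda>\<alpha>. c (q \<xi>) (x \<xi> \<alpha>)) (?l r)"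
      using same[OF that(2,1)] unfolding data_def prod.inject by (elim conjE)
    then show "c (q \<xi>) (x \<eta> \<alpha>) = c (q \<xi>) (x \<xi> \<alpha>)"
      using that(3) r(1) eqs(2)[OF that(1,2)] by simp
  qed
  \<comment> \<open>On the root coordinates closeness is automatic, so closeness on \<open>b \<xi>\<close> puts \<open>x \<eta>\<close> into \<open>U \<xi>\<close>.\<close>
  have contra: False if V2: "\<xi> \<in> V" "\<eta> \<in> V" "\<xi> < \<eta>"
    and close: "\<And>\<alpha>. \<alpha> \<in> b \<xi> \<Longrightarrow> dist (x \<eta> \<alpha>) (x \<xi> \<alpha>) < inverse (real (Suc (q \<xi>)))" for \<xi> \<eta>
  proof -
    have "dist (x \<eta> \<alpha>) (x \<xi> \<alpha>) < inverse (real (Suc (q \<xi>)))" if "\<alpha> \<in> K \<xi>" for \<alpha>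
      using that close[of \<alpha>] near[OF V2(1,2), of \<alpha>] by (cases "\<alpha> \<in> r") (auto simp: b_def a_def)
    then have "x \<eta> \<in> U \<xi>" using KU[OF xH] by blast
    with right[OF V2(3)] show False by simp
  qed
  obtain \<zeta> where \<zeta>: "\<zeta> \<in> V" using V(1) by (metis countable_empty ex_in_conv)
  define S where "S = sum_list (N \<zeta>)"
  define k where "k = length (N \<zeta>)"
  have NV: "N \<xi> = N \<zeta>" if "\<xi> \<in> V" for \<xi> using eqs(1)[OF that \<zeta>] .
  have kV: "length (?l (b \<xi>)) = k" if "\<xi> \<in> V" for \<xi>
    using arg_cong[OF NV[OF that], of length] by (simp add: k_def N_def)
  show False
  proof (cases "S = 0")
    case True
    \<comment> \<open>Without factors outside the root all the points coincide.\<close>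
    have const: "x \<xi> \<alpha> = w_prod e L z (n \<zeta>) r \<alpha>" if "\<xi> \<in> V" "\<alpha> \<in> X" for \<xi> \<alpha>
    proof -
      have "\<forall>k\<in>set (N \<xi>). k = 0" using True NV[OF that(1)] by (simp add: S_def)
      then have "w_prod e L z (n \<xi>) (b \<xi>) \<alpha> = 1" using fb by (simp add: N_def w_prod_def)
      then show ?thesis using split[of \<xi> \<alpha>] that V(2) wr[OF that(1) \<zeta>] by auto
    qed
    have "\<not> V \<subseteq> {\<zeta>}" using V(1) countable_subset by blast
    then obtain \<eta> where \<eta>: "\<eta> \<in> V" "\<eta> \<noteq> \<zeta>" by blast
    have same_x: "dist (x \<xi>' \<alpha>) (x \<xi> \<alpha>) < inverse (real (Suc (q \<xi>)))"
      if "\<xi> \<in> V" "\<xi>' \<in> V" "\<alpha> \<in> b \<xi>" for \<xi> \<xi>' \<alpha>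
    proof -
      have "\<alpha> \<in> X" using that bX(1)[of \<xi>] V(2) by blast
      then show ?thesis using const[OF that(1)] const[OF that(2)] by simp
    qed
    show False
      using contra[OF \<zeta> \<eta>(1) _ same_x[OF \<zeta> \<eta>(1)]] contra[OF \<eta>(1) \<zeta> _ same_x[OF \<eta>(1) \<zeta>]] \<eta>(2)
      by (metis neqE)
  next
    case False
    have inj: "inj_on b V"
      using disj own V(2) by (intro inj_onI) (metis IntI empty_iff subsetD)
    have uncb: "uncountable (b ` V)" using V(1) inj countable_image_inj_on by blast
    have card: "\<forall>u\<in>b ` V. finite u \<and> card u = k" using fb kV by auto
    have disjb: "disjoint (b ` V)"
      using disj V(2) by (intro disjointI) (metis imageE subsetD)
    have "uncountable (b ` V) \<and> (\<forall>u\<in>b ` V. finite u \<and> card u = k) \<and> disjoint (b ` V) \<and>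
        uncountable (b ` V) \<and> (\<forall>u\<in>b ` V. finite u \<and> card u = k) \<and> disjoint (b ` V)"
      by (intro conjI uncb card disjb)
    from moore[unfolded moore_property_def, THEN spec, THEN spec, THEN spec, THEN spec, THEN spec,
        THEN mp, OF this, of "s \<zeta>"]
    obtain A B where A: "A \<in> b ` V" and B: "\<forall>m<s \<zeta>. B m \<in> b ` V"
      and AB: "\<forall>i<k. \<forall>j<k. \<forall>m<s \<zeta>. set_less A (B m) \<and>
        osc e L (?l A ! i) (?l (B m) ! j) = osc e L (?l A ! i) (?l (B 0) ! j) + m"
      by (elim bexE exE conjE)
    obtain \<xi> where \<xi>: "\<xi> \<in> V" "A = b \<xi>" using A by blast
    have "\<forall>m. \<exists>y. m < s \<zeta> \<longrightarrow> y \<in> V \<and> B m = b y" using B by blast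
    from choice[OF this] obtain \<eta> where "\<forall>m. m < s \<zeta> \<longrightarrow> \<eta> m \<in> V \<and> B m = b (\<eta> m)" ..
    then have \<eta>: "\<eta> m \<in> V" "B m = b (\<eta> m)" if "m < s \<zeta>" for m using that by auto
    have kpos: "0 < k"
      using kV[OF \<zeta>] own[of \<zeta>] \<zeta> V(2) fb[of \<zeta>]
      by (metis card_gt_0_iff empty_iff length_sorted_list_of_set subsetD)
    have less: "\<alpha> < \<beta>" if "m < s \<zeta>" "\<alpha> \<in> b \<xi>" "\<beta> \<in> b (\<eta> m)" for m \<alpha> \<beta>
      using AB kpos that \<xi>(2) \<eta>(2)[OF that(1)] unfolding set_less_def by metis
    define C where "C \<alpha> = (\<Prod>j<k. (z \<alpha> ^ (osc e L \<alpha> (?l (B 0) ! j) + 1)) ^ (N \<zeta> ! j))" for \<alpha>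
    have shift: "w_prod e L z (n (\<eta> m)) (b (\<eta> m)) \<alpha> = C \<alpha> * (z \<alpha> ^ S) ^ m"
      if m: "m < s \<zeta>" and \<alpha>: "\<alpha> \<in> b \<xi>" for m \<alpha>
    proof -
      obtain i where i: "i < k" "\<alpha> = ?l (b \<xi>) ! i"
        using \<alpha> fb kV[OF \<xi>(1)] by (metis in_set_conv_nth set_sorted_list_of_set)
      have "osc e L \<alpha> (?l (b (\<eta> m)) ! j) = osc e L \<alpha> (?l (B 0) ! j) + m" if "j < k" for j
        using AB i that m \<xi>(2) \<eta>(2)[OF m] by metis
      then have "w_prod e L z (n (\<eta> m)) (b (\<eta> m)) \<alpha> =
          (\<Prod>j<k. (z \<alpha> ^ (osc e L \<alpha> (?l (B 0) ! j) + 1)) ^ (map (n (\<eta> m)) (?l (b (\<eta> m))) ! j)) *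
          (z \<alpha> ^ sum_list (map (n (\<eta> m)) (?l (b (\<eta> m))))) ^ m"
        using kV[OF \<eta>(1)[OF m]] less[OF m \<alpha>] by (intro w_prod_shift[OF fb]) auto
      then show ?thesis using NV[OF \<eta>(1)[OF m]] by (simp add: C_def S_def N_def)
    qed
    \<comment> \<open>On \<open>b \<xi>\<close> the points \<open>x (\<eta> m)\<close> have the form \<open>D \<alpha> * (z \<alpha> ^ S) ^ m\<close> with \<open>D\<close> independent of \<open>m\<close>, so
      Kronecker's theorem yields an \<open>m\<close> for which this is close to \<open>x \<xi> \<alpha>\<close>.\<close>
    define D where "D \<alpha> = w_prod e L z (n \<xi>) r \<alpha> * C \<alpha>" for \<alpha>
    have D1: "norm (D \<alpha>) = 1" for \<alpha>
      by (simp add: D_def C_def norm_mult norm_w_prod z1 norm_power flip: prod_norm)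
    have "norm (x \<xi> \<alpha> / D \<alpha>) = 1" if "\<alpha> \<in> b \<xi>" for \<alpha>
    proof -
      have "\<alpha> \<in> X" using that bX(1)[of \<xi>] \<xi>(1) V(2) by blast
      then show ?thesis by (simp add: x norm_divide D1 norm_w_prod z1)
    qed
    then obtain m where m: "m < s \<xi>"
      "\<And>\<alpha>. \<alpha> \<in> b \<xi> \<Longrightarrow> dist ((z \<alpha> ^ S) ^ m) (x \<xi> \<alpha> / D \<alpha>) < inverse (real (Suc (q \<xi>)))"
      using spec[OF iffD1[OF apx_def s[of \<xi>]], of "\<lambda>\<alpha>. x \<xi> \<alpha> / D \<alpha>"] False NV[OF \<xi>(1)]
      unfolding S_def by auto
    have ms: "m < s \<zeta>" using m(1) eqs(3)[OF \<xi>(1) \<zeta>] by simp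
    have \<eta>V: "\<eta> m \<in> V" using \<eta>(1)[OF ms] .
    show False
    proof (rule contra[OF \<xi>(1) \<eta>V])
      show "\<xi> < \<eta> m" using less[OF ms own own] \<xi>(1) \<eta>V V(2) by blast
      fix \<alpha> assume \<alpha>: "\<alpha> \<in> b \<xi>"
      have "\<alpha> \<in> X" using \<alpha> bX(1)[of \<xi>] \<xi>(1) V(2) by blast
      then have "x (\<eta> m) \<alpha> = D \<alpha> * (z \<alpha> ^ S) ^ m"
        using split[of "\<eta> m" \<alpha>] \<eta>V V(2) shift[OF ms \<alpha>] wr[OF \<eta>V \<xi>(1)] by (auto simp: D_def)
      moreover have "D \<alpha> \<noteq> 0" using D1[of \<alpha>] by auto
      ultimately have "dist (x (\<eta> m) \<alpha>) (x \<xi> \<alpha>) = norm (D \<alpha> * ((z \<alpha> ^ S) ^ m - x \<xi> \<alpha> / D \<alpha>))"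
        by (simp add: dist_norm algebra_simps)
      also have "\<dots> = dist ((z \<alpha> ^ S) ^ m) (x \<xi> \<alpha> / D \<alpha>)" by (simp add: norm_mult D1 dist_norm)
      also have "\<dots> < inverse (real (Suc (q \<xi>)))" by (rule m(2)[OF \<alpha>])
      finally show "dist (x (\<eta> m) \<alpha>) (x \<xi> \<alpha>) < inverse (real (Suc (q \<xi>)))" .
    qed
  qed
qed

theorem theorem2p2:
  fixes e :: "omega1 \<Rightarrow> omega1 \<Rightarrow> nat"
    and L :: "omega1 \<Rightarrow> omega1 \<Rightarrow> omega1 set"
    and z :: "omega1 \<Rightarrow> complex"
    and X :: "omega1 set"
  assumes "coherent_sequence e"
    and "lower_trace L"
    and "moore_property (osc e L)"
    and "\<forall>\<alpha>. z \<alpha> \<in> sphere 0 1"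
    and "rationally_independent z"
    and "uncountable X"
  shows "L_space (subtopology (torus_topology X) (sgrp (torus_group X) (L_set e L z X))) \<and>
    L_subsemigroup (torus_group X) (torus_topology X) (sgrp (torus_group X) (L_set e L z X)) \<and>
    cancellative (torus_group X) (sgrp (torus_group X) (L_set e L z X))"
proof -
  have sub: "subsemigroup (sgrp (torus_group X) (L_set e L z X)) (torus_group X)"
    using group_torus_group L_set_subset_carrier[OF assms(4)]
    by (intro sgrp_subsemigroup) (auto simp: group.is_monoid)
  moreover have "L_space (subtopology (torus_topology X) (sgrp (torus_group X) (L_set e L z X)))"
    unfolding L_space_def
    using regular_t1_torus_subspace hereditarily_Lindelof_sgrp_L_set[OF assms(3-6)]
      not_separable_sgrp_L_set[OF assms(4-6)] by blast
  ultimately show ?thesis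
    unfolding L_subsemigroup_def
    using topological_semigroup_torus[OF sub] cancellative_subsemigroup[OF group_torus_group sub] by blast
qed

end
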